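(* Let $R>0$, let $I=(-R,R)$, and let $\beta>0$. Let $f:\mathbb{R}\to\mathbb{R}$ and let $u\in C^2([-R,R])$ be a solution to $$\begin{cases} -u''=f(u) & \text{in } I,\\ \dfrac{\partial u}{\partial \nu}(x)+\beta u(x)=0 & \text{at } x=\pm R.\end{cases}$$ Assume that: (i) $f\ge 0$ in $\mathbb{R}$, and $f$ is not identically zero on $u(I)$; (ii) $f=f_1+f_2$, where $f_1:\mathbb{R}\to\mathbb{R}$ is locally Lipschitz and $f_2:\mathbb{R}\to\mathbb{R}$ is non-decreasing. Then $u(x)=u(-x)$ for all $x\in[-R,R]$. Moreover, $u'(x)<0$ for all $x\in(0,R]$.
   Context: $\partial u/\partial\nu$ denotes the outer normal derivative at the endpoints of the interval, i.e. $\frac{\partial u}{\partial\nu}(R)=u'(R)$ and $\frac{\partial u}{\partial\nu}(-R)=-u'(-R)$. *)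

theory Defs
  imports "HOL-Analysis.Analysis"
begin

(* Derivative relative to S: for S = {a..b} with a < b it is the ordinary derivative in the
   interior and the one-sided derivative at the endpoints, so that values of u outside {a..b}
   play no role. *)
definition deriv_on :: "real set \<Rightarrow> (real \<Rightarrow> real) \<Rightarrow> real \<Rightarrow> real" where
  "deriv_on S u x = vector_derivative u (at x within S)"

definition C2_on :: "real set \<Rightarrow> (real \<Rightarrow> real) \<Rightarrow> bool" where
  "C2_on S u \<longleftrightarrow>
     u differentiable_on S \<and>
     deriv_on S u differentiable_on S \<and>
     continuous_on S (deriv_on S (deriv_on S u))"

(* The outer unit normal of the interval (a, b), meaningful only at the endpoints a and b. *)
definition outer_normal :: "real \<Rightarrow> real \<Rightarrow> real \<Rightarrow> real" where
  "outer_normal a b x = (if x = b then 1 else if x = a then -1 else 0)"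

definition normal_deriv :: "real \<Rightarrow> real \<Rightarrow> (real \<Rightarrow> real) \<Rightarrow> real \<Rightarrow> real" where
  "normal_deriv a b u x = outer_normal a b x * deriv_on {a..b} u x"

definition locally_lipschitz :: "(real \<Rightarrow> real) \<Rightarrow> bool" where
  "locally_lipschitz g \<longleftrightarrow> (\<forall>x. \<exists>e>0. \<exists>L. L-lipschitz_on (cball x e) g)"

end

theory Submission
  imports Defs
begin

text \<open>
  By concavity and the Robin condition, \<open>u'(-R) > 0 > u'(R)\<close>, so \<open>u\<close> has a maximum point \<open>a\<close> in the
  interior. There \<open>f (u a) > 0\<close>: otherwise \<open>w = u a - u\<close> satisfies \<open>w'' \<le> L w\<close> (the Lipschitz bound
  for \<open>f1\<close>, and \<open>f2 (u a - w) \<le> f2 (u a)\<close>) with vanishing Cauchy data at \<open>a\<close>, so that \<open>u\<close> would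
  be constant to the right of \<open>a\<close>. Hence \<open>a\<close> is the only critical point.
  Parametrise the two arms \<open>s \<mapsto> u (a + s)\<close> and \<open>s \<mapsto> u (a - s)\<close> by their height \<open>t\<close>. On both, the
  squared slope has derivative \<open>- 2 f t\<close> and vanishes at the top, so the slopes agree at equal
  heights. The Robin condition then forces the arms to end at the same height, and integrating the
  reciprocal slope shows that they coincide; in particular \<open>a = 0\<close>. This energy argument needs no
  continuity of \<open>f\<close>.
\<close>

text \<open>Strict monotonicity lets the height serve as parameter. In the chain rule for the square
  of \<open>z (g t)\<close>, the factor \<open>z (g t)\<close> cancels against
  \<open>inverse (z (g t))\<close> and leaves \<open>- 2 * f t\<close>. Since \<open>z 0\<close> may
  vanish, derivatives are claimed only strictly between the end heights; continuity carries the
  information to the ends.\<close>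

lemma inverse_of_decreasing_arm:
  fixes y z f :: "real \<Rightarrow> real"
  assumes "l > 0"
    and conty: "continuous_on {0..l} y" and contz: "continuous_on {0..l} z"
    and dy: "\<And>s. 0 < s \<Longrightarrow> s < l \<Longrightarrow> (y has_real_derivative z s) (at s)"
    and dz: "\<And>s. 0 < s \<Longrightarrow> s < l \<Longrightarrow> (z has_real_derivative - f (y s)) (at s)"
    and neg: "\<And>s. 0 < s \<Longrightarrow> s \<le> l \<Longrightarrow> z s < 0"
  obtains g where "\<And>s. s \<in> {0..l} \<Longrightarrow> g (y s) = s"
    and "\<And>s. s \<in> {0..l} \<Longrightarrow> y l \<le> y s \<and> y s \<le> y 0"
    and "\<And>t. t \<in> {y l..y 0} \<Longrightarrow> g t \<in> {0..l} \<and> y (g t) = t"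
    and "continuous_on {y l..y 0} g"
    and "continuous_on {y l..y 0} (\<lambda>t. (z (g t))\<^sup>2)"
    and "\<And>t. y l < t \<Longrightarrow> t < y 0 \<Longrightarrow> 0 < g t \<and> g t < l"
    and "\<And>t. y l < t \<Longrightarrow> t < y 0 \<Longrightarrow> (g has_real_derivative inverse (z (g t))) (at t)"
    and "\<And>t. y l < t \<Longrightarrow> t < y 0 \<Longrightarrow> ((\<lambda>t. (z (g t))\<^sup>2) has_real_derivative - 2 * f t) (at t)"
proof -
  have less: "y t < y s" if "0 \<le> s" "s < t" "t \<le> l" for s t
  proof (rule DERIV_neg_imp_decreasing_open[OF \<open>s < t\<close>])
    show "\<exists>d. (y has_real_derivative d) (at x) \<and> d < 0" if "s < x" "x < t" for x
      using dy[of x] neg[of x] that \<open>0 \<le> s\<close> \<open>t \<le> l\<close> by auto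
    show "continuous_on {s..t} y"
      using conty by (rule continuous_on_subset) (use that in auto)
  qed
  have bounds: "y l \<le> y s \<and> y s \<le> y 0" if "s \<in> {0..l}" for s
    using less[of 0 s] less[of s l] that by (cases "s = 0"; cases "s = l") auto
  have inj: "inj_on y {0..l}"
    by (rule inj_onI, rule ccontr) (metis atLeastAtMost_iff less linorder_neqE order_less_irrefl)
  have img: "y ` {0..l} = {y l..y 0}"
  proof
    show "{y l..y 0} \<subseteq> y ` {0..l}"
    proof
      fix t assume "t \<in> {y l..y 0}"
      then show "t \<in> y ` {0..l}"
        using IVT2'[of y l t 0] conty \<open>l > 0\<close> by auto
    qed
  qed (use bounds in auto)
  define g where "g = the_inv_into {0..l} y"
  have gy: "g (y s) = s" if "s \<in> {0..l}" for s
    unfolding g_def using inj that by (rule the_inv_into_f_f)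
  have yg: "g t \<in> {0..l} \<and> y (g t) = t" if "t \<in> {y l..y 0}" for t
    using that gy unfolding img[symmetric] by auto
  have contg: "continuous_on {y l..y 0} g"
    unfolding img[symmetric] by (rule continuous_on_inv[OF conty]) (use gy in auto)
  have contzg: "continuous_on {y l..y 0} (\<lambda>t. (z (g t))\<^sup>2)"
    by (intro continuous_intros continuous_on_compose2[OF contz contg]) (use yg in auto)
  have inside: "0 < g t \<and> g t < l" if "y l < t" "t < y 0" for t
  proof -
    have "g t \<in> {0..l}" "y (g t) = t" using yg that by auto
    then show ?thesis using that by (cases "g t = 0"; cases "g t = l") auto
  qed
  have dg: "(g has_real_derivative inverse (z (g t))) (at t)" if "y l < t" "t < y 0" for t
  proof (rule DERIV_inverse_function)
    show "(y has_real_derivative z (g t)) (at (g t))" "z (g t) \<noteq> 0"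
      using dy neg[of "g t"] inside[OF that] by auto
    show "isCont g t"
      using contg that by (simp add: continuous_on_interior)
  qed (use that yg in auto)
  have "((\<lambda>t. (z (g t))\<^sup>2) has_real_derivative - 2 * f t) (at t)" if "y l < t" "t < y 0" for t
  proof -
    have "z (g t) \<noteq> 0" "y (g t) = t" using neg[of "g t"] inside[OF that] yg that by auto
    moreover have "((\<lambda>t. z (g t)) has_real_derivative - f (y (g t)) * inverse (z (g t))) (at t)"
      using DERIV_chain2[OF dz dg] inside that by blast
    ultimately show ?thesis
      by (auto intro!: derivative_eq_intros simp: field_simps)
  qed
  with gy bounds yg contg contzg inside dg show ?thesis by (rule that)
qed

text \<open>The energy argument for two arms descending from a common top, the arm that ends no
  higher being listed first. By \<open>anti\<close> the first arm is steepest at its end, which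
  together with the Robin relations keeps it from passing below the end of the second.\<close>

lemma decreasing_arms_coincide:
  fixes y1 z1 y2 z2 f :: "real \<Rightarrow> real"
  assumes "l1 > 0" "continuous_on {0..l1} y1" "continuous_on {0..l1} z1"
    and "\<And>s. 0 < s \<Longrightarrow> s < l1 \<Longrightarrow> (y1 has_real_derivative z1 s) (at s)"
    and "\<And>s. 0 < s \<Longrightarrow> s < l1 \<Longrightarrow> (z1 has_real_derivative - f (y1 s)) (at s)"
    and neg1: "\<And>s. 0 < s \<Longrightarrow> s \<le> l1 \<Longrightarrow> z1 s < 0"
    and "l2 > 0" "continuous_on {0..l2} y2" "continuous_on {0..l2} z2"
    and "\<And>s. 0 < s \<Longrightarrow> s < l2 \<Longrightarrow> (y2 has_real_derivative z2 s) (at s)"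
    and "\<And>s. 0 < s \<Longrightarrow> s < l2 \<Longrightarrow> (z2 has_real_derivative - f (y2 s)) (at s)"
    and neg2: "\<And>s. 0 < s \<Longrightarrow> s \<le> l2 \<Longrightarrow> z2 s < 0"
    and top: "z1 0 = 0" "z2 0 = 0" "y1 0 = y2 0"
    and robin: "z1 l1 = - \<beta> * y1 l1" "z2 l2 = - \<beta> * y2 l2" "\<beta> > 0"
    and anti: "\<And>s. s \<in> {0..l1} \<Longrightarrow> z1 l1 \<le> z1 s"
    and le: "y1 l1 \<le> y2 l2"
  shows "l1 = l2 \<and> (\<forall>s\<in>{0..l1}. y1 s = y2 s)"
proof -
  obtain g1 where g1: "\<And>s. s \<in> {0..l1} \<Longrightarrow> g1 (y1 s) = s"
    "\<And>s. s \<in> {0..l1} \<Longrightarrow> y1 l1 \<le> y1 s \<and> y1 s \<le> y1 0"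
    "\<And>t. t \<in> {y1 l1..y1 0} \<Longrightarrow> g1 t \<in> {0..l1} \<and> y1 (g1 t) = t"
    "continuous_on {y1 l1..y1 0} g1"
    "continuous_on {y1 l1..y1 0} (\<lambda>t. (z1 (g1 t))\<^sup>2)"
    "\<And>t. y1 l1 < t \<Longrightarrow> t < y1 0 \<Longrightarrow> 0 < g1 t \<and> g1 t < l1"
    "\<And>t. y1 l1 < t \<Longrightarrow> t < y1 0 \<Longrightarrow> (g1 has_real_derivative inverse (z1 (g1 t))) (at t)"
    "\<And>t. y1 l1 < t \<Longrightarrow> t < y1 0 \<Longrightarrow> ((\<lambda>t. (z1 (g1 t))\<^sup>2) has_real_derivative - 2 * f t) (at t)"
    by (rule inverse_of_decreasing_arm[OF assms(1-6)]) blast+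
  obtain g2 where g2: "\<And>s. s \<in> {0..l2} \<Longrightarrow> g2 (y2 s) = s"
    "\<And>s. s \<in> {0..l2} \<Longrightarrow> y2 l2 \<le> y2 s \<and> y2 s \<le> y2 0"
    "\<And>t. t \<in> {y2 l2..y2 0} \<Longrightarrow> g2 t \<in> {0..l2} \<and> y2 (g2 t) = t"
    "continuous_on {y2 l2..y2 0} g2"
    "continuous_on {y2 l2..y2 0} (\<lambda>t. (z2 (g2 t))\<^sup>2)"
    "\<And>t. y2 l2 < t \<Longrightarrow> t < y2 0 \<Longrightarrow> 0 < g2 t \<and> g2 t < l2"
    "\<And>t. y2 l2 < t \<Longrightarrow> t < y2 0 \<Longrightarrow> (g2 has_real_derivative inverse (z2 (g2 t))) (at t)"
    "\<And>t. y2 l2 < t \<Longrightarrow> t < y2 0 \<Longrightarrow> ((\<lambda>t. (z2 (g2 t))\<^sup>2) has_real_derivative - 2 * f t) (at t)"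
    by (rule inverse_of_decreasing_arm[OF assms(7-12)]) blast+
  define d where "d = y2 l2"
  define M where "M = y1 0"
  have M2: "y2 0 = M" using top M_def by simp
  have gM: "g1 M = 0" "g2 M = 0"
    using g1(1)[of 0] g2(1)[of 0] M2 \<open>l1 > 0\<close> \<open>l2 > 0\<close> by (auto simp: M_def)
  have g2d: "g2 d = l2" using g2(1)[of l2] \<open>l2 > 0\<close> by (auto simp: d_def)
  have "d \<noteq> M" using gM g2d \<open>l2 > 0\<close> by auto
  moreover have "d \<le> M" using g2(2)[of l2] \<open>l2 > 0\<close> M2 by (auto simp: d_def)
  ultimately have dM: "d < M" by simp
  \<comment> \<open>Both arms reach every height between the end of the second arm and the
    top.\<close>
  have sub: "{d..M} \<subseteq> {y1 l1..y1 0}" "{d..M} \<subseteq> {y2 l2..y2 0}"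
    using le M2 by (auto simp: d_def M_def)
  \<comment> \<open>The term \<open>- 2 * f t\<close> cancels in the difference of the squares,
    which is therefore constant; it vanishes at \<open>M\<close>, where both slopes are
    zero.\<close>
  have sq: "(z1 (g1 t))\<^sup>2 = (z2 (g2 t))\<^sup>2" if "t \<in> {d..M}" for t
  proof (cases "t = M")
    case False
    have "(z1 (g1 M))\<^sup>2 - (z2 (g2 M))\<^sup>2 = (z1 (g1 t))\<^sup>2 - (z2 (g2 t))\<^sup>2"
    proof (rule DERIV_isconst_end[where f = "\<lambda>t. (z1 (g1 t))\<^sup>2 - (z2 (g2 t))\<^sup>2"])
      show "t < M" using that False by auto
      show "continuous_on {t..M} (\<lambda>t. (z1 (g1 t))\<^sup>2 - (z2 (g2 t))\<^sup>2)"
        by (intro continuous_on_diff continuous_on_subset[OF g1(5)] continuous_on_subset[OF g2(5)])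
           (use that sub in auto)
      show "((\<lambda>t. (z1 (g1 t))\<^sup>2 - (z2 (g2 t))\<^sup>2) has_real_derivative 0) (at x)" if "t < x" "x < M" for x
        using DERIV_diff[OF g1(8)[of x] g2(8)[of x]] that \<open>t \<in> {d..M}\<close> le M2
        by (auto simp: d_def M_def)
    qed
    then show ?thesis by (simp add: gM top)
  qed (simp add: gM top)
  \<comment> \<open>The common sign selects the same square root for both arms.\<close>
  have nonpos: "z1 (g1 t) \<le> 0 \<and> z2 (g2 t) \<le> 0" if "t \<in> {d..M}" for t
  proof -
    have "g1 t \<in> {0..l1}" "g2 t \<in> {0..l2}" using g1(3) g2(3) sub that by blast+
    then show ?thesis using neg1[of "g1 t"] neg2[of "g2 t"] top
      by (cases "g1 t = 0"; cases "g2 t = 0") auto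
  qed
  have eq: "z1 (g1 t) = z2 (g2 t)" if "t \<in> {d..M}" for t
    using sq[OF that] nonpos[OF that] by (auto simp: power2_eq_iff)
  \<comment> \<open>At height \<open>d\<close> the first arm has the end slope of the second,
    \<open>- \<beta> * d\<close>. Its own end slope \<open>- \<beta> * y1 l1\<close> is no larger,
    so \<open>y1 l1\<close> is at least \<open>d\<close>, and \<open>le\<close> leaves only
    equality.\<close>
  have "z1 (g1 d) = - \<beta> * d" using eq[of d] dM g2d robin by (simp add: d_def)
  moreover have "z1 l1 \<le> z1 (g1 d)" using anti g1(3) sub dM by auto
  ultimately have "\<beta> * d \<le> \<beta> * y1 l1" using robin by simp
  then have ends: "y1 l1 = d" using le \<open>\<beta> > 0\<close> by (simp add: d_def)
  \<comment> \<open>Both inverses have the same reciprocal slope as derivative and the value 0 at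
    \<open>M\<close>. The reciprocal is singular at the top, but continuity of the inverses bridges
    that point.\<close>
  have geq: "g1 t = g2 t" if "t \<in> {d..M}" for t
  proof (cases "t = M")
    case False
    have "g1 M - g2 M = g1 t - g2 t"
    proof (rule DERIV_isconst_end[where f = "\<lambda>t. g1 t - g2 t"])
      show "t < M" using that False by auto
      show "continuous_on {t..M} (\<lambda>t. g1 t - g2 t)"
        by (intro continuous_on_diff continuous_on_subset[OF g1(4)] continuous_on_subset[OF g2(4)])
           (use that sub in auto)
      show "((\<lambda>t. g1 t - g2 t) has_real_derivative 0) (at x)" if "t < x" "x < M" for x
        using DERIV_diff[OF g1(7)[of x] g2(7)[of x]] eq[of x] that \<open>t \<in> {d..M}\<close> le M2
        by (auto simp: d_def M_def)
    qed
    then show ?thesis by (simp add: gM)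
  qed (simp add: gM)
  have l: "l1 = l2" using geq[of d] dM g1(1)[of l1] g2d ends \<open>l1 > 0\<close> by auto
  have "y1 s = y2 s" if "s \<in> {0..l1}" for s
  proof -
    have t: "y1 s \<in> {d..M}" using g1(2)[OF that] ends by (simp add: M_def)
    then have "g2 (y1 s) = s" using geq g1(1)[OF that] by simp
    moreover have "y2 (g2 (y1 s)) = y1 s" using g2(3) t sub by blast
    ultimately show ?thesis by simp
  qed
  with l show ?thesis by blast
qed

text \<open>Replaces uniqueness for the Cauchy problem when \<open>q\<close> is bounded from one
  side only. As \<open>v\<close> is nonnegative, multiplying the inequality by \<open>v\<close>
  shows that \<open>v\<close> squared minus \<open>L\<close> times \<open>w\<close> squared is
  nonincreasing. Hence \<open>v \<le> sqrt L * w\<close>, and Gronwall's argument applies.\<close>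

lemma vanishing_of_differential_inequality:
  fixes w v :: "real \<Rightarrow> real"
  assumes contw: "continuous_on {a..b} w" and contv: "continuous_on {a..b} v"
    and dw: "\<And>x. a < x \<Longrightarrow> x < b \<Longrightarrow> (w has_real_derivative v x) (at x)"
    and dv: "\<And>x. a < x \<Longrightarrow> x < b \<Longrightarrow> (v has_real_derivative q x) (at x)"
    and q: "\<And>x. a < x \<Longrightarrow> x < b \<Longrightarrow> q x \<le> L * w x"
    and nonneg: "\<And>x. x \<in> {a..b} \<Longrightarrow> 0 \<le> w x" "\<And>x. x \<in> {a..b} \<Longrightarrow> 0 \<le> v x"
    and init: "w a = 0" "v a = 0" and "L \<ge> 0" and x: "x \<in> {a..b}"
  shows "v x = 0"
proof -
  have sub: "continuous_on {a..t} w" "continuous_on {a..t} v" if "t \<in> {a..b}" for t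
    using that by (auto intro: continuous_on_subset[OF contw] continuous_on_subset[OF contv])
  have bound: "v t \<le> sqrt L * w t" if t: "t \<in> {a..b}" for t
  proof -
    have "(v t)\<^sup>2 - L * (w t)\<^sup>2 \<le> (v a)\<^sup>2 - L * (w a)\<^sup>2"
    proof (rule DERIV_nonpos_imp_decreasing_open[where f = "\<lambda>t. (v t)\<^sup>2 - L * (w t)\<^sup>2"])
      show "continuous_on {a..t} (\<lambda>t. (v t)\<^sup>2 - L * (w t)\<^sup>2)"
        by (intro continuous_intros sub t)
      fix x assume x: "a < x" "x < t"
      then have xb: "x < b" using t by simp
      have "((\<lambda>t. (v t)\<^sup>2 - L * (w t)\<^sup>2) has_real_derivative 2 * v x * (q x - L * w x)) (at x)"
        using dw[OF x(1) xb] dv[OF x(1) xb]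
        by (auto intro!: derivative_eq_intros simp: algebra_simps)
      moreover have "2 * v x * (q x - L * w x) \<le> 0"
        using q[OF x(1) xb] nonneg(2)[of x] x xb by (simp add: mult_nonneg_nonpos)
      ultimately show "\<exists>y. ((\<lambda>t. (v t)\<^sup>2 - L * (w t)\<^sup>2) has_real_derivative y) (at x) \<and> y \<le> 0"
        by blast
    qed (use t in auto)
    then have "(v t)\<^sup>2 \<le> (sqrt L * w t)\<^sup>2"
      using init \<open>L \<ge> 0\<close> by (simp add: power_mult_distrib)
    then show ?thesis
      by (rule power2_le_imp_le) (use nonneg t \<open>L \<ge> 0\<close> in auto)
  qed
  \<comment> \<open>Gronwall's integrating factor: by \<open>bound\<close> this product is
    nonincreasing, and it starts at 0.\<close>
  have "w x * exp (- sqrt L * x) \<le> w a * exp (- sqrt L * a)"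
  proof (rule DERIV_nonpos_imp_decreasing_open[where f = "\<lambda>t. w t * exp (- sqrt L * t)"])
    show "continuous_on {a..x} (\<lambda>t. w t * exp (- sqrt L * t))"
      by (intro continuous_intros sub x)
    fix t assume t: "a < t" "t < x"
    then have tb: "t < b" using x by simp
    have "((\<lambda>t. w t * exp (- sqrt L * t)) has_real_derivative
        (v t - sqrt L * w t) * exp (- sqrt L * t)) (at t)"
      using dw[OF t(1) tb] by (auto intro!: derivative_eq_intros simp: algebra_simps)
    moreover have "(v t - sqrt L * w t) * exp (- sqrt L * t) \<le> 0"
      using bound[of t] t tb by (simp add: mult_nonpos_nonneg)
    ultimately show "\<exists>y. ((\<lambda>t. w t * exp (- sqrt L * t)) has_real_derivative y) (at t) \<and> y \<le> 0"
      by blast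
  qed (use x in auto)
  then have "w x \<le> 0" using init by (simp add: mult_le_0_iff)
  then have "w x = 0" using nonneg(1)[OF x] by simp
  then show ?thesis using bound[OF x] nonneg(2)[OF x] by simp
qed

lemma locally_lipschitz_compact:
  assumes "locally_lipschitz g" "compact K"
  obtains L where "L \<ge> 0" "L-lipschitz_on K g"
proof -
  \<comment> \<open>The function is treated as a time-dependent family with the single time 0, to
    which the compactness theorem for \<open>local_lipschitz\<close> applies.\<close>
  have "local_lipschitz {0::real} UNIV (\<lambda>_. g)"
  proof (rule local_lipschitzI)
    fix t x :: real
    obtain e L where "e > 0" "L-lipschitz_on (cball x e) g"
      using assms(1) unfolding locally_lipschitz_def by metis
    then show "\<exists>u>0. \<exists>L. \<forall>t\<in>cball t u \<inter> {0}. L-lipschitz_on (cball x u \<inter> UNIV) g"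
      by auto
  qed
  then have "local_lipschitz {0::real} K (\<lambda>_. g)"
    by (rule local_lipschitz_subset) auto
  then obtain L where "L-lipschitz_on K g"
    using local_lipschitz_compact_implies_lipschitz[of "{0::real}" K "\<lambda>_. g"] assms(2) by auto
  then show ?thesis using that lipschitz_on_nonneg by blast
qed

theorem theorem2p1:
  fixes R \<beta> :: real and f f1 f2 u :: "real \<Rightarrow> real"
  assumes "R > 0" and "\<beta> > 0"
    and "C2_on {-R..R} u"
    and "\<And>x. x \<in> {-R<..<R} \<Longrightarrow> - deriv_on {-R..R} (deriv_on {-R..R} u) x = f (u x)"
    and "\<And>x. x \<in> {-R, R} \<Longrightarrow> normal_deriv (-R) R u x + \<beta> * u x = 0"
    and "\<And>t. f t \<ge> 0"
    and "\<exists>t \<in> u ` {-R<..<R}. f t \<noteq> 0"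
    and "\<And>t. f t = f1 t + f2 t"
    and "locally_lipschitz f1"
    and "mono f2"
  shows "(\<forall>x \<in> {-R..R}. u x = u (-x)) \<and> (\<forall>x \<in> {0<..R}. deriv_on {-R..R} u x < 0)"
proof -
  define D where "D = deriv_on {-R..R} u"
  \<comment> \<open>\<open>vector_derivative\<close> is a choice term; differentiability makes it an
    actual derivative, one-sided at the endpoints.\<close>
  have deriv: "(h has_real_derivative deriv_on {-R..R} h x) (at x within {-R..R})"
    if "h differentiable_on {-R..R}" "x \<in> {-R..R}" for h x
    using that unfolding deriv_on_def has_real_derivative_iff_has_vector_derivative
    by (simp add: differentiable_on_def vector_derivative_works)
  have diff: "u differentiable_on {-R..R}" "D differentiable_on {-R..R}"
    using assms(3) by (auto simp: C2_on_def D_def)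
  have cont: "continuous_on {-R..R} u" "continuous_on {-R..R} D"
    using diff by (auto intro: differentiable_imp_continuous_on)
  have du: "(u has_real_derivative D x) (at x)" if "-R < x" "x < R" for x
    using deriv[OF diff(1), of x] that by (simp add: D_def at_within_Icc_at)
  have dD: "(D has_real_derivative - f (u x)) (at x)" if "-R < x" "x < R" for x
  proof -
    have "deriv_on {-R..R} D x = - f (u x)"
      using assms(4)[of x] that by (simp add: D_def flip: minus_equation_iff)
    then show ?thesis
      using deriv[OF diff(2), of x] that by (simp add: at_within_Icc_at)
  qed
  have robin: "D R = - \<beta> * u R" "D (-R) = \<beta> * u (-R)"
    using assms(5)[of R] assms(5)[of "-R"] \<open>R > 0\<close>
    by (auto simp: normal_deriv_def outer_normal_def D_def)
  have anti: "D y \<le> D x" if "-R \<le> x" "x \<le> y" "y \<le> R" for x y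
  proof (rule DERIV_nonpos_imp_decreasing_open[OF \<open>x \<le> y\<close>])
    show "\<exists>d. (D has_real_derivative d) (at t) \<and> d \<le> 0" if "x < t" "t < y" for t
      using dD[of t] assms(6)[of "u t"] that \<open>-R \<le> x\<close> \<open>y \<le> R\<close> by fastforce
    show "continuous_on {x..y} D"
      using cont(2) by (rule continuous_on_subset) (use that in auto)
  qed
  \<comment> \<open>Concavity passes a nonnegative slope at \<open>y\<close> on to every point to
    its left.\<close>
  have mono: "u x \<le> u y" if "-R \<le> x" "x \<le> y" "y \<le> R" "D y \<ge> 0" for x y
  proof (rule DERIV_nonneg_imp_increasing_open[OF \<open>x \<le> y\<close>])
    show "\<exists>d. (u has_real_derivative d) (at t) \<and> d \<ge> 0" if "x < t" "t < y" for t
      using du[of t] anti[of t y] that \<open>-R \<le> x\<close> \<open>y \<le> R\<close> \<open>D y \<ge> 0\<close> by fastforce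
    show "continuous_on {x..y} u"
      using cont(1) by (rule continuous_on_subset) (use that in auto)
  qed
  have mono': "u y \<le> u x" if "-R \<le> x" "x \<le> y" "y \<le> R" "D x \<le> 0" for x y
  proof (rule DERIV_nonpos_imp_decreasing_open[OF \<open>x \<le> y\<close>])
    show "\<exists>d. (u has_real_derivative d) (at t) \<and> d \<le> 0" if "x < t" "t < y" for t
      using du[of t] anti[of x t] that \<open>-R \<le> x\<close> \<open>y \<le> R\<close> \<open>D x \<le> 0\<close> by fastforce
    show "continuous_on {x..y} u"
      using cont(1) by (rule continuous_on_subset) (use that in auto)
  qed
  \<comment> \<open>As \<open>D\<close> is nonincreasing, these signs would force it to vanish
    throughout, and then \<open>f\<close> would vanish on all values of \<open>u\<close> in the open
    interval.\<close>
  have nonconst: "\<not> (D (-R) \<le> 0 \<and> D R \<ge> 0)"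
  proof
    assume *: "D (-R) \<le> 0 \<and> D R \<ge> 0"
    have zero: "D x = 0" if "-R \<le> x" "x \<le> R" for x
      using anti[of "-R" x] anti[of x R] * that by simp
    have "f (u x) = 0" if "-R < x" "x < R" for x
    proof -
      have "(D has_real_derivative 0) (at x)"
        by (rule has_field_derivative_transform_within_open[of "\<lambda>_. 0" _ _ "{-R<..<R}"])
           (use that zero in auto)
      then show ?thesis using DERIV_unique[OF dD] that by fastforce
    qed
    then show False using assms(7) by auto
  qed
  \<comment> \<open>A nonnegative slope at \<open>R\<close> gives \<open>u R \<le> 0\<close> by the
    Robin condition and makes \<open>u\<close> nondecreasing, so \<open>u (-R) \<le> 0\<close>. The
    condition at the other end then yields \<open>D (-R) \<le> 0\<close>, which
    \<open>nonconst\<close> excludes.\<close>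
  have DR: "D R < 0"
  proof (rule ccontr)
    assume *: "\<not> D R < 0"
    then have "u R \<le> 0" using robin \<open>\<beta> > 0\<close> by (simp add: not_less mult_le_0_iff)
    moreover have "u (-R) \<le> u R" using mono * \<open>R > 0\<close> by simp
    ultimately have "D (-R) \<le> 0" using robin \<open>\<beta> > 0\<close> by (simp add: mult_le_0_iff)
    with * nonconst show False by simp
  qed
  have DL: "D (-R) > 0"
  proof (rule ccontr)
    assume *: "\<not> D (-R) > 0"
    then have "u (-R) \<le> 0" using robin \<open>\<beta> > 0\<close> by (simp add: not_less mult_le_0_iff)
    moreover have "u R \<le> u (-R)" using mono' * \<open>R > 0\<close> by simp
    ultimately have "D R \<ge> 0" using robin \<open>\<beta> > 0\<close> by (simp add: mult_le_0_iff)
    with * nonconst show False by simp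
  qed
  obtain a where a: "-R \<le> a" "a \<le> R" "D a = 0"
    using IVT2'[of D R 0 "-R"] DL DR cont \<open>R > 0\<close> by auto
  have aI: "-R < a" "a < R" using a DL DR by (cases "a = R"; cases "a = -R"; force)+
  obtain L where L: "L \<ge> 0" "L-lipschitz_on (u ` {-R..R}) f1"
    using locally_lipschitz_compact[OF assms(9)] compact_continuous_image[OF cont(1)] by blast
  \<comment> \<open>Stated for every interior critical point, since uniqueness applies it away from
    \<open>a\<close>. The comparison runs to the right of \<open>c\<close> and would give slope 0 at
    \<open>R\<close>, contradicting \<open>DR\<close>.\<close>
  have crit: "f (u c) > 0" if c: "-R < c" "c < R" "D c = 0" for c
  proof (rule ccontr)
    assume "\<not> f (u c) > 0"
    then have fc: "f (u c) = 0" using assms(6)[of "u c"] by simp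
    have le: "u x \<le> u c" if "x \<in> {c..R}" for x using mono'[of c x] that c by auto
    have "- D R = 0"
    proof (rule vanishing_of_differential_inequality[where a = c and b = R and v = "\<lambda>x. - D x"
          and w = "\<lambda>x. u c - u x" and q = "\<lambda>x. f (u x)" and L = L])
      show "continuous_on {c..R} (\<lambda>x. u c - u x)" "continuous_on {c..R} (\<lambda>x. - D x)"
        using c by (auto intro!: continuous_intros intro: continuous_on_subset[OF cont(1)]
            continuous_on_subset[OF cont(2)])
      fix x assume x: "c < x" "x < R"
      show "((\<lambda>x. u c - u x) has_real_derivative - D x) (at x)"
        using du[of x] x c by (auto intro!: derivative_eq_intros)
      show "((\<lambda>x. - D x) has_real_derivative f (u x)) (at x)"
        using dD[of x] x c by (auto intro!: derivative_eq_intros)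
      have "dist (f1 (u x)) (f1 (u c)) \<le> L * dist (u x) (u c)"
        using x c by (intro lipschitz_onD[OF L(2)]) auto
      then have "f1 (u x) - f1 (u c) \<le> L * (u c - u x)"
        using le[of x] x by (simp add: dist_real_def abs_minus_commute)
      moreover have "f2 (u x) \<le> f2 (u c)"
        using le[of x] x assms(10) by (auto dest: monoD)
      ultimately show "f (u x) \<le> L * (u c - u x)"
        using fc assms(8)[of "u c"] assms(8)[of "u x"] by simp
    qed (use le anti[of c] c L in auto)
    with DR show False by simp
  qed
  \<comment> \<open>Between two critical points the monotone \<open>D\<close> would vanish
    identically. The midpoint would then be critical with \<open>f (u x) = 0\<close>, contrary to
    \<open>crit\<close>.\<close>
  have uniq: "c = a" if c: "-R < c" "c < R" "D c = 0" for c
  proof (rule ccontr)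
    assume "c \<noteq> a"
    define p q where "p = min a c" and "q = max a c"
    have pq: "p < q" "-R < p" "q < R" "D p = 0" "D q = 0"
      using \<open>c \<noteq> a\<close> c a aI by (auto simp: p_def q_def min_def max_def)
    have zero: "D x = 0" if "p < x" "x < q" for x
      using anti[of p x] anti[of x q] that pq by auto
    define x where "x = (p + q) / 2"
    have x: "p < x" "x < q" using pq by (auto simp: x_def)
    have "(D has_real_derivative 0) (at x)"
      by (rule has_field_derivative_transform_within_open[of "\<lambda>_. 0" _ _ "{p<..<q}"])
         (use zero x in auto)
    then have "f (u x) = 0" using DERIV_unique[OF dD, of x] x pq by fastforce
    then show False using crit[of x] zero[OF x] x pq by simp
  qed
  have neg: "D x < 0" if "a < x" "x \<le> R" for x
  proof (cases "x = R")
    case False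
    then have "D x \<noteq> 0" using uniq[of x] that aI by auto
    then show ?thesis using anti[of a x] that a by simp
  qed (use DR in simp)
  have pos: "D x > 0" if "-R \<le> x" "x < a" for x
  proof (cases "x = -R")
    case False
    then have "D x \<noteq> 0" using uniq[of x] that aI by auto
    then show ?thesis using anti[of x a] that a by simp
  qed (use DL in simp)
  have shift: "continuous_on {0..R - a} (\<lambda>s. h (a + s))" "continuous_on {0..R + a} (\<lambda>s. h (a - s))"
    if "continuous_on {-R..R} h" for h :: "real \<Rightarrow> real"
    using aI by (auto intro!: continuous_on_compose2[OF that] continuous_intros)
  have dright: "((\<lambda>s. u (a + s)) has_real_derivative D (a + s)) (at s)"
    "((\<lambda>s. D (a + s)) has_real_derivative - f (u (a + s))) (at s)" if "0 < s" "s < R - a" for s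
    using du[of "a + s"] dD[of "a + s"] that aI DERIV_at_within_shift[of _ _ a s UNIV] by simp_all
  \<comment> \<open>Reflection flips the sign of the slope but preserves the second-order equation,
    so both arms are governed by the same \<open>f\<close>.\<close>
  have dleft: "((\<lambda>s. u (a - s)) has_real_derivative - D (a - s)) (at s)"
    "((\<lambda>s. - D (a - s)) has_real_derivative - f (u (a - s))) (at s)" if "0 < s" "s < R + a" for s
  proof -
    have m: "((\<lambda>s. a - s) has_real_derivative -1) (at s)" by (auto intro!: derivative_eq_intros)
    show "((\<lambda>s. u (a - s)) has_real_derivative - D (a - s)) (at s)"
      using DERIV_chain2[OF du m] that aI by simp
    show "((\<lambda>s. - D (a - s)) has_real_derivative - f (u (a - s))) (at s)"
      using DERIV_minus[OF DERIV_chain2[OF dD m]] that aI by simp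
  qed
  \<comment> \<open>Monotonicity of \<open>D\<close> with the Robin values inserted at the ends;
    this supplies the premise that an arm is steepest at its end.\<close>
  have ends: "- (\<beta> * u R) \<le> D x" "D x \<le> \<beta> * u (-R)" if "-R \<le> x" "x \<le> R" for x
    using anti[of x R] anti[of "-R" x] robin that by simp_all
  \<comment> \<open>The arm ending no higher must come first, so the two cases differ only in the
    order of the arms. Equal lengths \<open>R - a\<close> and \<open>R + a\<close> then put the top
    at the centre.\<close>
  have arms: "R - a = R + a \<and> (\<forall>s\<in>{0..R - a}. u (a + s) = u (a - s))"
  proof (cases "u R \<le> u (-R)")
    case True
    show ?thesis
      by (rule decreasing_arms_coincide[where ?y1.0 = "\<lambda>s. u (a + s)" and ?z1.0 = "\<lambda>s. D (a + s)"
            and ?y2.0 = "\<lambda>s. u (a - s)" and ?z2.0 = "\<lambda>s. - D (a - s)" and f = f and \<beta> = \<beta>])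
         (use aI a True robin \<open>\<beta> > 0\<close> shift cont dright dleft neg pos ends in
           \<open>auto intro!: continuous_on_minus\<close>)
  next
    case False
    have "R + a = R - a \<and> (\<forall>s\<in>{0..R + a}. u (a - s) = u (a + s))"
      by (rule decreasing_arms_coincide[where ?y1.0 = "\<lambda>s. u (a - s)" and ?z1.0 = "\<lambda>s. - D (a - s)"
            and ?y2.0 = "\<lambda>s. u (a + s)" and ?z2.0 = "\<lambda>s. D (a + s)" and f = f and \<beta> = \<beta>])
         (use aI a False robin \<open>\<beta> > 0\<close> shift cont dright dleft neg pos ends in
           \<open>auto intro!: continuous_on_minus\<close>)
    then show ?thesis by auto
  qed
  then have "a = 0" by simp
  have even: "u x = u (-x)" if "x \<in> {-R..R}" for x
    \<comment> \<open>The arms are compared at distance \<open>\<bar>x\<bar>\<close> from the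
      centre, which covers both signs of \<open>x\<close>.\<close>
    using arms that \<open>a = 0\<close> by (cases "x \<ge> 0") (auto dest: bspec[where x = "\<bar>x\<bar>"])
  have "\<forall>x\<in>{0<..R}. D x < 0" using neg \<open>a = 0\<close> by simp
  with even show ?thesis unfolding D_def by blast
qed

end
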